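(* Let $M=\mathrm{Span}\{e_{11},e_{22},e_{23},e_{32},e_{33}\}$. Let $M_3(\mathbb{C})=A\oplus B$ be a direct vector-space sum of two subalgebras with $\dim A=4$ and $\dim B=5$, where $B$ is the image of $M$ under some automorphism or antiautomorphism of $M_3(\mathbb{C})$. Then there is a map $\varphi\colon M_3(\mathbb{C})\to M_3(\mathbb{C})$, which is an automorphism or an antiautomorphism of $M_3(\mathbb{C})$, such that $\varphi(B)=M$ and $\varphi(A)=S$, where $S$ is one of the following subalgebras: (V1) $\mathrm{Span}\{e_{21}-e_{23},\ e_{11}+e_{22}+e_{31},\ e_{12}+e_{32},\ e_{13}+e_{22}+e_{33}\}$; (V2) $\mathrm{Span}\{e_{21}-e_{23},\ e_{11}+e_{22}+e_{31},\ e_{12}+e_{23}+e_{32},\ e_{13}+e_{22}+e_{33}\}$; (V3) $\mathrm{Span}\{e_{21}-e_{23},\ e_{11}+e_{31},\ e_{12}+e_{32},\ e_{13}+e_{33}\}$; (V4) $\mathrm{Span}\{e_{21}+e_{22}-e_{23},\ e_{11}+e_{31},\ e_{12}+e_{32},\ e_{13}+e_{33}\}$; (V5) $\mathrm{Span}\{e_{21}-e_{23},\ e_{11}+e_{22}+e_{31},\ e_{12}+e_{22}+se_{23}+e_{32},\ e_{13}+e_{22}+e_{33}\}$ for some $s\in\mathbb{C}$; (V6) $\mathrm{Span}\{e_{21}+be_{22}-(b+1)e_{23},\ e_{11}+e_{21}+e_{31},\ e_{12}+e_{22}+e_{32},\ e_{13}+e_{23}+e_{33}\}$ for some $b\in\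mathbb{C}$.
   Context: $M_3(\mathbb{C})$ is the algebra of $3\times3$ complex matrices, $e_{ij}$ are the matrix units, and $\mathrm{Span}$ means linear span over $\mathbb{C}$. A subalgebra is a $\mathbb{C}$-linear subspace closed under multiplication; it is not required to contain the identity matrix. An automorphism is a $\mathbb{C}$-algebra automorphism of $M_3(\mathbb{C})$; an antiautomorphism is the composition of an automorphism and the transpose map. The phrase "up to transpose and up to action of $\mathrm{Aut}(M_3(\mathbb{C}))$" is expressed in the claim by the existence of $\varphi$. *)

theory Defs
  imports "HOL-Analysis.Analysis"
begin

type_synonym mat3 = "complex^3^3"

text \<open>The index type \<^typ>\<open>3\<close> has the three elements 1, 2, 3 (where 3 = 0), so \<open>X $ i $ j\<close> with
  \<open>i\<close>, \<open>j\<close> among 1, 2, 3 is the entry of \<open>X\<close> in row \<open>i\<close> and column \<open>j\<close>.\<close>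

definition matrix_unit :: "3 \<Rightarrow> 3 \<Rightarrow> mat3" (\<open>E\<close>)
  where "E i j = axis i (axis j 1)"

text \<open>The library's scalar multiplications on \<^typ>\<open>mat3\<close> have real scalars (\<^const>\<open>scaleR\<close>) or row
  vectors as scalars (\<^const>\<open>vector_scalar_mult\<close>), so the complex one is defined here.\<close>

definition cscale :: "complex \<Rightarrow> mat3 \<Rightarrow> mat3"  (infixr \<open>*\<^sub>C\<close> 75)
  where "c *\<^sub>C X = (\<chi> i j. c * X $ i $ j)"

lemma cscale_nth [simp]: "(c *\<^sub>C X) $ i $ j = c * X $ i $ j"
  by (simp add: cscale_def)

lemma matrix_unit_nth: "E i j $ k $ l = (if k = i \<and> l = j then 1 else 0)"
  by (simp add: matrix_unit_def axis_def)

interpretation M3: vector_space cscale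
  by unfold_locales (simp_all add: vec_eq_iff algebra_simps)

lemma matrix_unit_inject [simp]: "E i j = E k l \<longleftrightarrow> i = k \<and> j = l"
  by (auto simp: matrix_unit_def axis_eq_axis)

lemma mat3_expand: "X = (\<Sum>(i,j)\<in>UNIV. X $ i $ j *\<^sub>C E i j)"
proof -
  have "(\<Sum>p\<in>UNIV. (case p of (i,j) \<Rightarrow> X $ i $ j *\<^sub>C E i j)) $ k $ l = X $ k $ l" for k l
  proof -
    have "(\<Sum>p\<in>UNIV. (case p of (i,j) \<Rightarrow> X $ i $ j *\<^sub>C E i j)) $ k $ l
        = (\<Sum>p\<in>UNIV. if p = (k,l) then X $ k $ l else 0)"
      unfolding sum_component
      by (rule sum.cong) (auto simp: matrix_unit_nth split: prod.splits)
    then show ?thesis by simp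
  qed
  then show ?thesis by (simp add: vec_eq_iff)
qed

interpretation M3: finite_dimensional_vector_space cscale "range (\<lambda>(i,j). E i j)"
proof unfold_locales
  show "finite (range (\<lambda>(i,j). E i j))" by simp
  have inj: "inj (\<lambda>(i,j). E i j)" by (auto simp: inj_on_def)
  show "M3.independent (range (\<lambda>(i,j). E i j))"
  proof (rule M3.independent_if_scalars_zero)
    fix f x
    assume 0: "(\<Sum>x\<in>range (\<lambda>(i,j). E i j). f x *\<^sub>C x) = 0" and "x \<in> range (\<lambda>(i,j). E i j)"
    then obtain k l where x: "x = E k l" by auto
    have "0 = (\<Sum>p\<in>UNIV. f (case_prod E p) *\<^sub>C case_prod E p) $ k $ l"
      using 0 inj by (simp add: sum.reindex o_def case_prod_unfold)
    also have "\<dots> = (\<Sum>p\<in>UNIV. if p = (k,l) then f (E k l) else 0)"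
      unfolding sum_component
      by (rule sum.cong) (auto simp: matrix_unit_nth split: prod.splits)
    finally show "f x = 0" by (simp add: x)
  qed simp
  show "M3.span (range (\<lambda>(i,j). E i j)) = UNIV"
  proof -
    have "X \<in> M3.span (range (\<lambda>(i,j). E i j))" for X
      by (subst mat3_expand)
        (auto intro!: M3.span_sum intro: M3.span_scale M3.span_base)
    then show ?thesis by auto
  qed
qed

definition subalgebra :: "mat3 set \<Rightarrow> bool"
  where "subalgebra A \<longleftrightarrow> M3.subspace A \<and> (\<forall>X\<in>A. \<forall>Y\<in>A. X ** Y \<in> A)"

definition direct_sum_decomp :: "mat3 set \<Rightarrow> mat3 set \<Rightarrow> bool"
  where "direct_sum_decomp A B \<longleftrightarrow>
    M3.subspace A \<and> M3.subspace B \<and> A \<inter> B = {0} \<and> {X + Y | X Y. X \<in> A \<and> Y \<in> B} = UNIV"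

text \<open>A bijective multiplicative map automatically preserves the identity matrix.\<close>

definition automorphism :: "(mat3 \<Rightarrow> mat3) \<Rightarrow> bool"
  where "automorphism f \<longleftrightarrow>
    Vector_Spaces.linear cscale cscale f \<and> bij f \<and> (\<forall>X Y. f (X ** Y) = f X ** f Y)"

definition antiautomorphism :: "(mat3 \<Rightarrow> mat3) \<Rightarrow> bool"
  where "antiautomorphism f \<longleftrightarrow> (\<exists>g. automorphism g \<and> f = g \<circ> transpose)"

definition M :: "mat3 set"
  where "M = M3.span {E 1 1, E 2 2, E 2 3, E 3 2, E 3 3}"

end

theory Submission
  imports Defs
begin

text \<open>
  Write a matrix in block form for \<open>\<complex>\<^sup>3 = \<complex> e\<^sub>1 \<oplus> \<complex>\<^sup>2\<close>, with corner entry \<open>\<alpha>\<close>, row \<open>r\<close>, column \<open>c\<close> and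
  lower block \<open>D\<close>. Then \<open>M\<close> is the set of block diagonal matrices, so a subspace \<open>A\<close> is complementary
  to \<open>M\<close> iff the pair \<open>(r, c)\<close> is a linear coordinate system on \<open>A\<close>: the remaining entries \<open>\<alpha>\<close> and
  \<open>D\<close> are linear functions of it, and two elements of \<open>A\<close> with the same \<open>(r, c)\<close> are equal. After
  undoing the given map, \<open>B = M\<close>, and \<open>A\<close> may be changed by the automorphisms and
  antiautomorphisms that preserve \<open>M\<close>: the transpose and conjugation by block diagonal matrices.

  The key relation is \<open>C R = \<alpha>(C) R + \<alpha>(R) C\<close> for \<open>C\<close> in \<open>A\<close> with zero row part and \<open>R\<close> in \<open>A\<close> with
  zero column part (\<open>corner_product\<close>): both sides have the same \<open>(r, c)\<close>. Its corner entry says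
  \<open>\<alpha>(C) \<alpha>(R) = 0\<close>, so \<open>\<alpha>\<close> depends on \<open>r\<close> alone or on \<open>c\<close> alone. Up to transpose it is the latter,
  that is, \<open>A e\<^sub>1\<close> is a plane not containing \<open>e\<^sub>1\<close>. This plane is invariant under \<open>A\<close>, hence it contains
  the image of every element of \<open>A\<close>, and some row vector annihilates \<open>A\<close> from the left
  (\<open>left_annihilator\<close>). A block diagonal conjugation turns this row vector into \<open>(1, 0, -1)\<close>, which
  makes the first and the third rows of all elements of \<open>A\<close> agree (\<open>equal_rows_normal_form\<close>).

  Now only the second row \<open>(t, p, q)\<close> is left to determine, where \<open>p\<close> and \<open>q\<close> are linear in the
  coordinates. The part of \<open>(p, q)\<close> that depends on \<open>r\<close> is \<open>r F\<close> for a \<open>2 \<times> 2\<close> matrix \<open>F\<close>. The key relation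
  and closure under multiplication leave two families with two parameters, according to whether \<open>F\<close> is
  scalar or not (\<open>equal_rows_classification\<close>). Conjugation by \<open>1 + \<beta> e\<^sub>2\<^sub>3\<close> adds a scalar to \<open>F\<close>
  up to similarity. It is used to kill \<open>F\<close> in the scalar case and the trace of \<open>F\<close> in the other case;
  the one parameter that survives is \<open>0\<close> or is scaled to \<open>1\<close> by a diagonal conjugation. This gives
  the algebras (V3) and (V4) in the scalar case and (V1) and (V2) in the nonscalar case. The
  families (V5) and (V6) have \<open>F\<close> nonscalar of trace \<open>1\<close> and \<open>F = 1\<close>, respectively, so the same
  conjugations take each of their members to one of these four.
\<close>

section \<open>Matrix entries and spans\<close>

lemma mult_nth:
  "((X::mat3) ** Y) $ i $ j = X $ i $ 1 * Y $ 1 $ j + X $ i $ 2 * Y $ 2 $ j + X $ i $ 3 * Y $ 3 $ j"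
  by (simp add: matrix_matrix_mult_def sum_3)

lemma mat3_eq_iff:
  "(X::mat3) = Y \<longleftrightarrow>
    X $ 1 $ 1 = Y $ 1 $ 1 \<and> X $ 1 $ 2 = Y $ 1 $ 2 \<and> X $ 1 $ 3 = Y $ 1 $ 3 \<and>
    X $ 2 $ 1 = Y $ 2 $ 1 \<and> X $ 2 $ 2 = Y $ 2 $ 2 \<and> X $ 2 $ 3 = Y $ 2 $ 3 \<and>
    X $ 3 $ 1 = Y $ 3 $ 1 \<and> X $ 3 $ 2 = Y $ 3 $ 2 \<and> X $ 3 $ 3 = Y $ 3 $ 3"
  by (auto simp: vec_eq_iff forall_3)

lemma mat_nth: "(mat c :: mat3) $ i $ j = (if i = j then c else 0)"
  by (simp add: mat_def)

lemma transpose_nth: "transpose X $ i $ j = X $ j $ i"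
  by (simp add: transpose_def)

lemmas entries = mult_nth mat_nth transpose_nth matrix_unit_nth

lemma mem_M_iff: "X \<in> M \<longleftrightarrow> X $ 1 $ 2 = 0 \<and> X $ 1 $ 3 = 0 \<and> X $ 2 $ 1 = 0 \<and> X $ 3 $ 1 = 0"
proof
  assume "X \<in> M"
  then show "X $ 1 $ 2 = 0 \<and> X $ 1 $ 3 = 0 \<and> X $ 2 $ 1 = 0 \<and> X $ 3 $ 1 = 0"
    by (auto simp: M_def M3.span_breakdown_eq mat3_eq_iff entries)
next
  assume X: "X $ 1 $ 2 = 0 \<and> X $ 1 $ 3 = 0 \<and> X $ 2 $ 1 = 0 \<and> X $ 3 $ 1 = 0"
  show "X \<in> M"
    by (auto simp: M_def M3.span_breakdown_eq mat3_eq_iff entries X)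
qed

lemma mem_span4_iff:
  "X \<in> M3.span {P, Q, R, S} \<longleftrightarrow>
    (\<exists>t a b c. X = t *\<^sub>C P + a *\<^sub>C Q + b *\<^sub>C R + c *\<^sub>C S)"
  by (simp add: M3.span_breakdown_eq algebra_simps)

section \<open>Maps preserving the multiplication up to order\<close>

definition algebra_symmetry :: "(mat3 \<Rightarrow> mat3) \<Rightarrow> bool"
  where "algebra_symmetry f \<longleftrightarrow> automorphism f \<or> antiautomorphism f"

lemma linear_cscale_iff:
  "Vector_Spaces.linear cscale cscale f \<longleftrightarrow>
    (\<forall>X Y. f (X + Y) = f X + f Y) \<and> (\<forall>c X. f (c *\<^sub>C X) = c *\<^sub>C f X)"
  by (simp add: Vector_Spaces.linear_iff M3.vector_space_axioms)

lemma transpose_add: "transpose (X + Y :: mat3) = transpose X + transpose Y"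
  and transpose_cscale: "transpose (c *\<^sub>C X) = c *\<^sub>C transpose X"
  by (simp_all add: mat3_eq_iff transpose_nth)

lemma bij_transpose: "bij (transpose :: mat3 \<Rightarrow> mat3)"
  by (rule o_bij[where g = transpose]) (auto simp: fun_eq_iff)

lemma antiautomorphism_iff:
  "antiautomorphism f \<longleftrightarrow>
    Vector_Spaces.linear cscale cscale f \<and> bij f \<and> (\<forall>X Y. f (X ** Y) = f Y ** f X)"
proof
  assume "antiautomorphism f"
  then show "Vector_Spaces.linear cscale cscale f \<and> bij f \<and> (\<forall>X Y. f (X ** Y) = f Y ** f X)"
    by (auto simp: antiautomorphism_def automorphism_def linear_cscale_iff transpose_add
        transpose_cscale matrix_transpose_mul intro: bij_comp bij_transpose)
next
  assume f: "Vector_Spaces.linear cscale cscale f \<and> bij f \<and> (\<forall>X Y. f (X ** Y) = f Y ** f X)"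
  then have "automorphism (f \<circ> transpose)"
    by (auto simp: automorphism_def linear_cscale_iff transpose_add
        transpose_cscale matrix_transpose_mul intro: bij_comp bij_transpose)
  moreover have "f = (f \<circ> transpose) \<circ> transpose"
    by (simp add: fun_eq_iff)
  ultimately show "antiautomorphism f"
    unfolding antiautomorphism_def by blast
qed

lemma algebra_symmetry_iff:
  "algebra_symmetry f \<longleftrightarrow>
    Vector_Spaces.linear cscale cscale f \<and> bij f \<and>
    ((\<forall>X Y. f (X ** Y) = f X ** f Y) \<or> (\<forall>X Y. f (X ** Y) = f Y ** f X))"
  by (auto simp: algebra_symmetry_def automorphism_def antiautomorphism_iff)

lemma algebra_symmetry_comp:
  assumes "algebra_symmetry f" "algebra_symmetry g"
  shows "algebra_symmetry (f \<circ> g)"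
  using assms by (auto simp: algebra_symmetry_iff linear_cscale_iff intro: bij_comp)

lemma algebra_symmetry_inv:
  assumes "algebra_symmetry f"
  shows "algebra_symmetry (inv f)"
proof -
  have bij: "bij f" and lin: "\<And>X Y. f (X + Y) = f X + f Y" "\<And>c X. f (c *\<^sub>C X) = c *\<^sub>C f X"
    and mult: "(\<forall>X Y. f (X ** Y) = f X ** f Y) \<or> (\<forall>X Y. f (X ** Y) = f Y ** f X)"
    using assms by (auto simp: algebra_symmetry_iff linear_cscale_iff)
  have eqI: "inv f Z = W" if "Z = f W" for Z W
    using that bij by (simp add: bij_is_inj)
  have f_inv: "f (inv f Z) = Z" for Z
    using bij by (simp add: bij_is_surj surj_f_inv_f)
  have "(\<forall>X Y. inv f (X ** Y) = inv f X ** inv f Y) \<or> (\<forall>X Y. inv f (X ** Y) = inv f Y ** inv f X)"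
    using mult by (elim disjE) (auto intro!: eqI simp: f_inv)
  moreover have "inv f (X + Y) = inv f X + inv f Y" "inv f (c *\<^sub>C X) = c *\<^sub>C inv f X" for c X Y
    by (rule eqI, simp add: lin f_inv)+
  ultimately show ?thesis
    using bij by (auto simp: algebra_symmetry_iff linear_cscale_iff bij_imp_bij_inv)
qed

lemma algebra_symmetry_transpose: "algebra_symmetry transpose"
  by (auto simp: algebra_symmetry_iff linear_cscale_iff transpose_add transpose_cscale
      matrix_transpose_mul bij_transpose)

lemma algebra_symmetry_conjugation:
  assumes "G ** H = mat 1"
  shows "algebra_symmetry (\<lambda>X. G ** X ** H)"
proof -
  have HG: "H ** G = mat 1"
    using assms by (simp add: matrix_left_right_inverse)
  have cancel: "H ** (G ** X) = X" "G ** (H ** X) = X" for X :: mat3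
    by (simp_all add: matrix_mul_assoc HG assms)
  have "bij (\<lambda>X. G ** X ** H)"
    by (rule o_bij[where g = "\<lambda>X. H ** X ** G"])
      (simp_all add: fun_eq_iff matrix_mul_assoc[symmetric] cancel HG assms)
  moreover have "G ** (X + Y) ** H = G ** X ** H + G ** Y ** H" for X Y
    by (simp add: mat3_eq_iff mult_nth algebra_simps)
  moreover have "G ** (c *\<^sub>C X) ** H = c *\<^sub>C (G ** X ** H)" for c X
    by (simp add: mat3_eq_iff mult_nth algebra_simps)
  moreover have "G ** (X ** Y) ** H = (G ** X ** H) ** (G ** Y ** H)" for X Y
    by (simp add: matrix_mul_assoc[symmetric] cancel)
  ultimately show ?thesis
    by (simp add: algebra_symmetry_iff linear_cscale_iff)
qed

lemma subalgebra_image: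
  assumes "algebra_symmetry f" "subalgebra A"
  shows "subalgebra (f ` A)"
proof -
  have lin: "Vector_Spaces.linear cscale cscale f"
    and mult: "(\<forall>X Y. f (X ** Y) = f X ** f Y) \<or> (\<forall>X Y. f (X ** Y) = f Y ** f X)"
    using assms by (auto simp: algebra_symmetry_iff)
  interpret f: Vector_Spaces.linear cscale cscale f by (fact lin)
  have "f X ** f Y \<in> f ` A" if "X \<in> A" "Y \<in> A" for X Y
    using mult that assms(2) unfolding subalgebra_def by (metis imageI)
  moreover have "M3.subspace (f ` A)"
    using assms(2) f.subspace_image by (simp add: subalgebra_def)
  ultimately show ?thesis
    by (auto simp: subalgebra_def)
qed

lemma direct_sum_decomp_image:
  assumes "algebra_symmetry f" "direct_sum_decomp A B"
  shows "direct_sum_decomp (f ` A) (f ` B)"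
proof -
  have lin: "Vector_Spaces.linear cscale cscale f" and bij: "bij f"
    using assms by (auto simp: algebra_symmetry_iff)
  interpret f: Vector_Spaces.linear cscale cscale f by (fact lin)
  have "f ` A \<inter> f ` B = {0}"
    using assms(2) bij by (simp add: direct_sum_decomp_def bij_is_inj f.zero flip: image_Int)
  moreover have "{X + Y |X Y. X \<in> f ` A \<and> Y \<in> f ` B} = f ` {X + Y |X Y. X \<in> A \<and> Y \<in> B}"
    by (force simp: f.add)
  ultimately show ?thesis
    using assms(2) bij f.subspace_image
    by (simp add: direct_sum_decomp_def bij_is_surj)
qed

section \<open>Subalgebras complementary to the block diagonal matrices\<close>

definition complements_M :: "mat3 set \<Rightarrow> bool"
  where "complements_M A \<longleftrightarrow> subalgebra A \<and> direct_sum_decomp A M"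

definition M_equivalent :: "mat3 set \<Rightarrow> mat3 set \<Rightarrow> bool"
  where "M_equivalent A A' \<longleftrightarrow> (\<exists>f. algebra_symmetry f \<and> f ` M = M \<and> f ` A = A')"

lemma M_equivalent_trans:
  assumes "M_equivalent A A'" "M_equivalent A' A''"
  shows "M_equivalent A A''"
proof -
  obtain f g where fg: "algebra_symmetry f" "f ` M = M" "f ` A = A'"
    "algebra_symmetry g" "g ` M = M" "g ` A' = A''"
    using assms by (auto simp: M_equivalent_def)
  have "(g \<circ> f) ` M = M" "(g \<circ> f) ` A = A''"
    using fg by (simp_all only: image_comp[symmetric])
  moreover have "algebra_symmetry (g \<circ> f)"
    using algebra_symmetry_comp[OF fg(4,1)] .
  ultimately show ?thesis
    unfolding M_equivalent_def by (intro exI[of _ "g \<circ> f"] conjI)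
qed

lemma M_equivalent_complements_M:
  assumes "M_equivalent A A'" "complements_M A"
  shows "complements_M A'"
  using assms subalgebra_image direct_sum_decomp_image
  unfolding M_equivalent_def complements_M_def by metis

lemma M_equivalent_transpose: "M_equivalent A (transpose ` A)"
proof -
  have "transpose ` M = M"
  proof -
    have "transpose X \<in> M \<longleftrightarrow> X \<in> M" for X
      by (auto simp: mem_M_iff transpose_nth)
    then show ?thesis
      by (force simp: image_iff intro: transpose_transpose[symmetric])
  qed
  then show ?thesis
    using algebra_symmetry_transpose by (auto simp: M_equivalent_def)
qed

lemma conjugation_image_M:
  assumes "G ** H = mat 1" "G \<in> M" "H \<in> M"
  shows "(\<lambda>X. G ** X ** H) ` M = M"
proof -
  have HG: "H ** G = mat 1"
    using assms by (simp add: matrix_left_right_inverse)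
  have M_mult: "X ** Y \<in> M" if "X \<in> M" "Y \<in> M" for X Y
    using that by (simp add: mem_M_iff mult_nth)
  have "X \<in> (\<lambda>X. G ** X ** H) ` M" if "X \<in> M" for X
  proof
    show "X = G ** (H ** X ** G) ** H"
      by (simp add: matrix_mul_assoc[symmetric] assms(1)) (simp add: matrix_mul_assoc assms(1))
  qed (use that assms M_mult in auto)
  then show ?thesis
    using assms M_mult by auto
qed

lemma M_equivalent_conjugation:
  assumes "G ** H = mat 1" "G \<in> M" "H \<in> M"
  shows "M_equivalent A ((\<lambda>X. G ** X ** H) ` A)"
  using algebra_symmetry_conjugation[OF assms(1)] conjugation_image_M[OF assms]
  by (auto simp: M_equivalent_def)

lemma M_equivalent_conjugationI:
  assumes "G ** H = mat 1" "G \<in> M" "H \<in> M"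
    and "\<And>X. G ** X ** H \<in> A' \<longleftrightarrow> X \<in> A"
  shows "M_equivalent A A'"
proof -
  have "surj (\<lambda>X. G ** X ** H)"
    using algebra_symmetry_conjugation[OF assms(1)] by (auto simp: algebra_symmetry_iff bij_is_surj)
  moreover have "A = (\<lambda>X. G ** X ** H) -` A'"
    using assms(4) by auto
  ultimately have "(\<lambda>X. G ** X ** H) ` A = A'"
    by (simp add: surj_image_vimage_eq)
  then show ?thesis
    using M_equivalent_conjugation[OF assms(1-3), of A] by simp
qed

context
  fixes A :: "mat3 set"
  assumes A: "complements_M A"
begin

lemma mult_closed: "X \<in> A \<Longrightarrow> Y \<in> A \<Longrightarrow> X ** Y \<in> A"
  using A by (simp add: complements_M_def subalgebra_def)

lemma subspace_A: "M3.subspace A"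
  using A by (simp add: complements_M_def subalgebra_def)

lemma coordinates_inj:
  assumes "X \<in> A" "Y \<in> A"
    and "X $ 1 $ 2 = Y $ 1 $ 2" "X $ 1 $ 3 = Y $ 1 $ 3" "X $ 2 $ 1 = Y $ 2 $ 1" "X $ 3 $ 1 = Y $ 3 $ 1"
  shows "X = Y"
proof -
  have "X - Y \<in> A \<inter> M"
    using assms subspace_A by (simp add: M3.subspace_diff mem_M_iff)
  moreover have "A \<inter> M = {0}"
    using A by (simp add: complements_M_def direct_sum_decomp_def)
  ultimately show ?thesis
    by simp
qed

lemma coordinates_surj:
  obtains X where "X \<in> A" "X $ 1 $ 2 = b" "X $ 1 $ 3 = c" "X $ 2 $ 1 = t" "X $ 3 $ 1 = a"
proof -
  let ?Z = "b *\<^sub>C E 1 2 + c *\<^sub>C E 1 3 + t *\<^sub>C E 2 1 + a *\<^sub>C E 3 1"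
  have "?Z \<in> {X + Y |X Y. X \<in> A \<and> Y \<in> M}"
    using A by (simp add: complements_M_def direct_sum_decomp_def)
  then obtain X Y where XY: "?Z = X + Y" "X \<in> A" "Y \<in> M"
    by blast
  show thesis
    using XY by (intro that[of X]) (auto simp: mat3_eq_iff entries mem_M_iff)
qed

lemma coordinate_basis:
  obtains T U V W where "T \<in> A" "U \<in> A" "V \<in> A" "W \<in> A"
    and "T $ 2 $ 1 = 1" "T $ 3 $ 1 = 0" "T $ 1 $ 2 = 0" "T $ 1 $ 3 = 0"
    and "U $ 2 $ 1 = 0" "U $ 3 $ 1 = 1" "U $ 1 $ 2 = 0" "U $ 1 $ 3 = 0"
    and "V $ 2 $ 1 = 0" "V $ 3 $ 1 = 0" "V $ 1 $ 2 = 1" "V $ 1 $ 3 = 0"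
    and "W $ 2 $ 1 = 0" "W $ 3 $ 1 = 0" "W $ 1 $ 2 = 0" "W $ 1 $ 3 = 1"
    and "\<And>X. X \<in> A \<Longrightarrow> X = X $ 2 $ 1 *\<^sub>C T + X $ 3 $ 1 *\<^sub>C U + X $ 1 $ 2 *\<^sub>C V + X $ 1 $ 3 *\<^sub>C W"
proof -
  obtain T where T: "T \<in> A" "T $ 1 $ 2 = 0" "T $ 1 $ 3 = 0" "T $ 2 $ 1 = 1" "T $ 3 $ 1 = 0"
    by (rule coordinates_surj)
  obtain U where U: "U \<in> A" "U $ 1 $ 2 = 0" "U $ 1 $ 3 = 0" "U $ 2 $ 1 = 0" "U $ 3 $ 1 = 1"
    by (rule coordinates_surj)
  obtain V where V: "V \<in> A" "V $ 1 $ 2 = 1" "V $ 1 $ 3 = 0" "V $ 2 $ 1 = 0" "V $ 3 $ 1 = 0"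
    by (rule coordinates_surj)
  obtain W where W: "W \<in> A" "W $ 1 $ 2 = 0" "W $ 1 $ 3 = 1" "W $ 2 $ 1 = 0" "W $ 3 $ 1 = 0"
    by (rule coordinates_surj)
  have "X = X $ 2 $ 1 *\<^sub>C T + X $ 3 $ 1 *\<^sub>C U + X $ 1 $ 2 *\<^sub>C V + X $ 1 $ 3 *\<^sub>C W" if "X \<in> A" for X
    by (rule coordinates_inj[OF that])
      (use T U V W subspace_A in \<open>auto intro!: M3.subspace_add M3.subspace_scale\<close>)
  then show thesis
    using that T U V W by blast
qed

text \<open>Both sides lie in \<open>A\<close> and have the same off-diagonal blocks, because the product of a matrix
  without row part and a matrix without column part has row part \<open>\<alpha>(C) r\<close> and column part \<open>\<alpha>(R) c\<close>.\<close>

lemma corner_product: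
  assumes "C \<in> A" "C $ 1 $ 2 = 0" "C $ 1 $ 3 = 0"
    and "R \<in> A" "R $ 2 $ 1 = 0" "R $ 3 $ 1 = 0"
  shows "C ** R = C $ 1 $ 1 *\<^sub>C R + R $ 1 $ 1 *\<^sub>C C"
  by (rule coordinates_inj)
    (use assms mult_closed subspace_A in
      \<open>auto intro!: M3.subspace_add M3.subspace_scale simp: mult_nth\<close>)

text \<open>In the corner entry of \<open>corner_product\<close> the product of the two corner entries occurs once on the
  left and twice on the right.\<close>

lemma corner_dichotomy:
  "(\<forall>R\<in>A. R $ 2 $ 1 = 0 \<longrightarrow> R $ 3 $ 1 = 0 \<longrightarrow> R $ 1 $ 1 = 0) \<or>
   (\<forall>C\<in>A. C $ 1 $ 2 = 0 \<longrightarrow> C $ 1 $ 3 = 0 \<longrightarrow> C $ 1 $ 1 = 0)"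
proof -
  have "C $ 1 $ 1 = 0 \<or> R $ 1 $ 1 = 0"
    if "C \<in> A" "C $ 1 $ 2 = 0" "C $ 1 $ 3 = 0" "R \<in> A" "R $ 2 $ 1 = 0" "R $ 3 $ 1 = 0" for C R
  proof -
    have "(C ** R) $ 1 $ 1 = C $ 1 $ 1 * R $ 1 $ 1 + R $ 1 $ 1 * C $ 1 $ 1"
      using corner_product[OF that] by simp
    then show ?thesis
      using that by (simp add: mult_nth)
  qed
  then show ?thesis
    by blast
qed

text \<open>The assumption says that \<open>A e\<^sub>1\<close> does not contain \<open>e\<^sub>1\<close>, so it is a plane, the kernel of a row
  vector \<open>w = (1, -y\<^sub>2, -y\<^sub>3)\<close>. For \<open>X\<close> in \<open>A\<close> the row vector \<open>w X\<close> vanishes on \<open>e\<^sub>1\<close> and, as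
  \<open>X A e\<^sub>1 \<subseteq> A e\<^sub>1\<close>, also on \<open>A e\<^sub>1\<close>. Together these span \<open>\<complex>\<^sup>3\<close>, so \<open>w X = 0\<close>.\<close>

lemma left_annihilator:
  assumes corner: "\<forall>R\<in>A. R $ 2 $ 1 = 0 \<longrightarrow> R $ 3 $ 1 = 0 \<longrightarrow> R $ 1 $ 1 = 0"
  obtains y2 y3 where "\<And>X j. X \<in> A \<Longrightarrow> X $ 1 $ j = y2 * X $ 2 $ j + y3 * X $ 3 $ j"
proof -
  obtain T U V W where basis: "T \<in> A" "U \<in> A" "V \<in> A" "W \<in> A"
    and T: "T $ 2 $ 1 = 1" "T $ 3 $ 1 = 0" "T $ 1 $ 2 = 0" "T $ 1 $ 3 = 0"
    and U: "U $ 2 $ 1 = 0" "U $ 3 $ 1 = 1" "U $ 1 $ 2 = 0" "U $ 1 $ 3 = 0"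
    and V: "V $ 2 $ 1 = 0" "V $ 3 $ 1 = 0" "V $ 1 $ 2 = 1" "V $ 1 $ 3 = 0"
    and W: "W $ 2 $ 1 = 0" "W $ 3 $ 1 = 0" "W $ 1 $ 2 = 0" "W $ 1 $ 3 = 1"
    and expand: "\<And>X. X \<in> A \<Longrightarrow> X = X $ 2 $ 1 *\<^sub>C T + X $ 3 $ 1 *\<^sub>C U + X $ 1 $ 2 *\<^sub>C V + X $ 1 $ 3 *\<^sub>C W"
    by (rule coordinate_basis) blast
  define y2 y3 where "y2 = T $ 1 $ 1" and "y3 = U $ 1 $ 1"
  have zero: "V $ 1 $ 1 = 0" "W $ 1 $ 1 = 0"
    using corner basis V W by auto
  have col1: "X $ 1 $ 1 = y2 * X $ 2 $ 1 + y3 * X $ 3 $ 1" if "X \<in> A" for X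
  proof -
    have "X $ 1 $ 1 = (X $ 2 $ 1 *\<^sub>C T + X $ 3 $ 1 *\<^sub>C U + X $ 1 $ 2 *\<^sub>C V + X $ 1 $ 3 *\<^sub>C W) $ 1 $ 1"
      using expand[OF that] by simp
    then show ?thesis
      by (simp add: zero y2_def y3_def mult.commute)
  qed
  have "X $ 1 $ j = y2 * X $ 2 $ j + y3 * X $ 3 $ j" if X: "X \<in> A" for X j
  proof -
    have prod: "X $ 1 $ 2 * C $ 2 $ 1 + X $ 1 $ 3 * C $ 3 $ 1
        = y2 * (X $ 2 $ 2 * C $ 2 $ 1 + X $ 2 $ 3 * C $ 3 $ 1)
        + y3 * (X $ 3 $ 2 * C $ 2 $ 1 + X $ 3 $ 3 * C $ 3 $ 1)" if "C \<in> A" for C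
      using col1[OF mult_closed[OF X that]] col1[OF X]
      by (simp add: mult_nth algebra_simps)
    have "X $ 1 $ 2 = y2 * X $ 2 $ 2 + y3 * X $ 3 $ 2"
      using prod[OF basis(1)] T by simp
    moreover have "X $ 1 $ 3 = y2 * X $ 2 $ 3 + y3 * X $ 3 $ 3"
      using prod[OF basis(2)] U by simp
    ultimately show ?thesis
      using col1[OF X] exhaust_3[of j] by metis
  qed
  then show thesis
    by (rule that)
qed

text \<open>Conjugation by \<open>1 \<oplus> h\<close> multiplies the annihilating row vector by the inverse of \<open>h\<close> on the
  right, so the last row of \<open>h\<close> has to be \<open>(y\<^sub>2, y\<^sub>3)\<close>; this is nonzero since the first rows of the
  elements of \<open>A\<close> are not all zero.\<close>

lemma equal_rows_if_corner_zero:
  assumes "\<forall>R\<in>A. R $ 2 $ 1 = 0 \<longrightarrow> R $ 3 $ 1 = 0 \<longrightarrow> R $ 1 $ 1 = 0"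
  obtains A' where "M_equivalent A A'" "\<And>X j. X \<in> A' \<Longrightarrow> X $ 1 $ j = X $ 3 $ j"
proof -
  obtain y2 y3 where y: "\<And>X j. X \<in> A \<Longrightarrow> X $ 1 $ j = y2 * X $ 2 $ j + y3 * X $ 3 $ j"
    using left_annihilator[OF assms] by blast
  obtain R where R: "R \<in> A" "R $ 1 $ 2 = 1" "R $ 1 $ 3 = 0" "R $ 2 $ 1 = 0" "R $ 3 $ 1 = 0"
    by (rule coordinates_surj)
  have nz: "y3 \<noteq> 0 \<or> y2 \<noteq> 0"
    using y[OF R(1), of 2] R by auto
  obtain G H where GH: "G ** H = mat 1" "G \<in> M" "H \<in> M"
    and G: "G $ 1 $ 1 = 1" "G $ 3 $ 2 = y2" "G $ 3 $ 3 = y3"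
  proof (cases "y3 = 0")
    case True
    show ?thesis
      by (rule that[of "E 1 1 + E 2 3 + y2 *\<^sub>C E 3 2" "E 1 1 + E 3 2 + inverse y2 *\<^sub>C E 2 3"])
        (use True nz in \<open>auto simp: mat3_eq_iff entries mem_M_iff\<close>)
  next
    case False
    show ?thesis
      by (rule that[of "E 1 1 + E 2 2 + y2 *\<^sub>C E 3 2 + y3 *\<^sub>C E 3 3"
              "E 1 1 + E 2 2 + (- y2 / y3) *\<^sub>C E 3 2 + inverse y3 *\<^sub>C E 3 3"])
        (use False in \<open>auto simp: mat3_eq_iff entries mem_M_iff field_simps\<close>)
  qed
  have rows: "(G ** X) $ 1 $ j = (G ** X) $ 3 $ j" if "X \<in> A" for X j
    using y[OF that, of j] GH G by (simp add: mult_nth mem_M_iff)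
  show thesis
  proof (rule that)
    show "M_equivalent A ((\<lambda>X. G ** X ** H) ` A)"
      by (rule M_equivalent_conjugation[OF GH])
    fix X j
    assume "X \<in> (\<lambda>X. G ** X ** H) ` A"
    then obtain Y where Y: "Y \<in> A" "X = (G ** Y) ** H"
      by blast
    then show "X $ 1 $ j = X $ 3 $ j"
      using rows[OF Y(1)] by (simp add: mult_nth[of "G ** Y" H])
  qed
qed

end

lemma equal_rows_normal_form:
  assumes "complements_M A"
  obtains A' where "M_equivalent A A'" "\<And>X j. X \<in> A' \<Longrightarrow> X $ 1 $ j = X $ 3 $ j"
proof (cases "\<forall>R\<in>A. R $ 2 $ 1 = 0 \<longrightarrow> R $ 3 $ 1 = 0 \<longrightarrow> R $ 1 $ 1 = 0")
  case True
  then show thesis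
    using equal_rows_if_corner_zero[OF assms] that by blast
next
  case False
  let ?A = "transpose ` A"
  have "\<forall>R\<in>?A. R $ 2 $ 1 = 0 \<longrightarrow> R $ 3 $ 1 = 0 \<longrightarrow> R $ 1 $ 1 = 0"
    using corner_dichotomy[OF assms] False by (simp add: transpose_nth)
  moreover have "complements_M ?A"
    using M_equivalent_complements_M[OF M_equivalent_transpose assms] .
  ultimately obtain A' where "M_equivalent ?A A'" "\<And>X j. X \<in> A' \<Longrightarrow> X $ 1 $ j = X $ 3 $ j"
    using equal_rows_if_corner_zero by blast
  then show thesis
    using M_equivalent_trans[OF M_equivalent_transpose] that by blast
qed

section \<open>The second row\<close>

text \<open>Elements of the following algebras have first and third row \<open>(a, b, c)\<close> and second row
  \<open>(t, a, -t) + (0, b, c) F\<close>, where \<open>F\<close> acts on the last two coordinates and has rows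
  \<open>(l, s)\<close> and \<open>(1, 0)\<close>.\<close>

definition nonscalar_algebra :: "complex \<Rightarrow> complex \<Rightarrow> mat3 set"
  where "nonscalar_algebra l s = {X. (\<forall>j. X $ 1 $ j = X $ 3 $ j) \<and>
    X $ 2 $ 2 = X $ 3 $ 1 + l * X $ 1 $ 2 + X $ 1 $ 3 \<and> X $ 2 $ 3 = s * X $ 1 $ 2 - X $ 2 $ 1}"

text \<open>Here \<open>F\<close> is the scalar \<open>l\<close>: the second row is \<open>l (a, b, c) + \<tau> (1, k, -(k l + 1))\<close>
  with \<open>\<tau> = t - l a\<close>.\<close>

definition scalar_algebra :: "complex \<Rightarrow> complex \<Rightarrow> mat3 set"
  where "scalar_algebra l k = {X. (\<forall>j. X $ 1 $ j = X $ 3 $ j) \<and>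
    X $ 2 $ 2 = l * X $ 1 $ 2 + k * (X $ 2 $ 1 - l * X $ 3 $ 1) \<and>
    X $ 2 $ 3 = l * X $ 1 $ 3 - (k * l + 1) * (X $ 2 $ 1 - l * X $ 3 $ 1)}"

lemma complement_eqI:
  assumes A: "complements_M A" and sub: "A \<subseteq> S"
    and inj: "\<And>X Y. X \<in> S \<Longrightarrow> Y \<in> S \<Longrightarrow> X $ 1 $ 2 = Y $ 1 $ 2 \<Longrightarrow> X $ 1 $ 3 = Y $ 1 $ 3 \<Longrightarrow>
      X $ 2 $ 1 = Y $ 2 $ 1 \<Longrightarrow> X $ 3 $ 1 = Y $ 3 $ 1 \<Longrightarrow> X = Y"
  shows "A = S"
proof (rule antisym[OF sub], rule subsetI)
  fix X assume X: "X \<in> S"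
  obtain Y where Y: "Y \<in> A" "Y $ 1 $ 2 = X $ 1 $ 2" "Y $ 1 $ 3 = X $ 1 $ 3"
    "Y $ 2 $ 1 = X $ 2 $ 1" "Y $ 3 $ 1 = X $ 3 $ 1"
    by (rule coordinates_surj[OF A])
  then have "Y = X"
    using sub X by (intro inj) auto
  then show "X \<in> A"
    using Y by simp
qed

text \<open>Let \<open>p\<^sub>i\<close> and \<open>q\<^sub>i\<close> be the last two entries of the second rows of the basis elements; \<open>F\<close> has
  rows \<open>(p\<^sub>3, q\<^sub>3)\<close> and \<open>(p\<^sub>4, q\<^sub>4)\<close>. The relation \<open>corner_product\<close> says that \<open>-p\<^sub>1 F\<close> and \<open>(1 - p\<^sub>2) F\<close>
  are the scalars \<open>1 + q\<^sub>1\<close> and \<open>q\<^sub>2\<close>. If \<open>F\<close> is not scalar, this fixes \<open>p\<^sub>1, q\<^sub>1, p\<^sub>2, q\<^sub>2\<close>. Closure of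
  the elements without column part then means \<open>p\<^sub>4 F + q\<^sub>4 = F\<close> (and \<open>p\<^sub>3 F + q\<^sub>3 = F\<^sup>2\<close>, which follows
  by Cayley--Hamilton), so \<open>p\<^sub>4 = 1\<close> and \<open>q\<^sub>4 = 0\<close>. If \<open>F\<close> is the scalar \<open>l\<close>, the product of
  \<open>V\<close> and \<open>T\<close> supplies the missing relation \<open>p\<^sub>2 = - l p\<^sub>1\<close>.\<close>

lemma equal_rows_classification:
  assumes A: "complements_M A" and rows: "\<And>X j. X \<in> A \<Longrightarrow> X $ 1 $ j = X $ 3 $ j"
  shows "(\<exists>l s. A = nonscalar_algebra l s) \<or> (\<exists>l k. A = scalar_algebra l k)"
proof -
  obtain T U V W where basis: "T \<in> A" "U \<in> A" "V \<in> A" "W \<in> A"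
    and T: "T $ 2 $ 1 = 1" "T $ 3 $ 1 = 0" "T $ 1 $ 2 = 0" "T $ 1 $ 3 = 0"
    and U: "U $ 2 $ 1 = 0" "U $ 3 $ 1 = 1" "U $ 1 $ 2 = 0" "U $ 1 $ 3 = 0"
    and V: "V $ 2 $ 1 = 0" "V $ 3 $ 1 = 0" "V $ 1 $ 2 = 1" "V $ 1 $ 3 = 0"
    and W: "W $ 2 $ 1 = 0" "W $ 3 $ 1 = 0" "W $ 1 $ 2 = 0" "W $ 1 $ 3 = 1"
    and expand: "\<And>X. X \<in> A \<Longrightarrow> X = X $ 2 $ 1 *\<^sub>C T + X $ 3 $ 1 *\<^sub>C U + X $ 1 $ 2 *\<^sub>C V + X $ 1 $ 3 *\<^sub>C W"
    by (rule coordinate_basis[OF A]) blast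
  define p1 q1 where "p1 = T $ 2 $ 2" and "q1 = T $ 2 $ 3"
  define p2 q2 where "p2 = U $ 2 $ 2" and "q2 = U $ 2 $ 3"
  define p3 q3 where "p3 = V $ 2 $ 2" and "q3 = V $ 2 $ 3"
  define p4 q4 where "p4 = W $ 2 $ 2" and "q4 = W $ 2 $ 3"
  note pq = p1_def[symmetric] q1_def[symmetric] p2_def[symmetric] q2_def[symmetric]
    p3_def[symmetric] q3_def[symmetric] p4_def[symmetric] q4_def[symmetric]
  have row3: "X $ 1 $ 1 = X $ 3 $ 1" "X $ 3 $ 2 = X $ 1 $ 2" "X $ 3 $ 3 = X $ 1 $ 3"
    if "X \<in> A" for X
    using rows[OF that] by simp_all
  note known = pq T U V W row3[OF basis(1)] row3[OF basis(2)] row3[OF basis(3)] row3[OF basis(4)]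
  have expand_p: "X $ 2 $ 2 = X $ 2 $ 1 * p1 + X $ 3 $ 1 * p2 + X $ 1 $ 2 * p3 + X $ 1 $ 3 * p4"
    and expand_q: "X $ 2 $ 3 = X $ 2 $ 1 * q1 + X $ 3 $ 1 * q2 + X $ 1 $ 2 * q3 + X $ 1 $ 3 * q4"
    if "X \<in> A" for X
    using arg_cong[OF expand[OF that], of "\<lambda>Z. Z $ 2 $ 2"]
      arg_cong[OF expand[OF that], of "\<lambda>Z. Z $ 2 $ 3"]
    by (simp_all add: pq)
  note product_p = expand_p[OF mult_closed[OF A]] and product_q = expand_q[OF mult_closed[OF A]]
  have TF: "1 + q1 + p1 * p3 = 0" "p1 * q3 = 0" "p1 * p4 = 0" "1 + q1 + p1 * q4 = 0"
    using product_p[OF basis(1,3)] product_q[OF basis(1,3)]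
      product_p[OF basis(1,4)] product_q[OF basis(1,4)]
    by (simp_all add: mult_nth known algebra_simps)
  have UF: "(1 - p2) * p3 = q2" "(1 - p2) * q3 = 0" "(1 - p2) * p4 = 0" "(1 - p2) * q4 = q2"
    using product_p[OF basis(2,3)] product_q[OF basis(2,3)]
      product_p[OF basis(2,4)] product_q[OF basis(2,4)]
    by (simp_all add: mult_nth known algebra_simps)
  show ?thesis
  proof (cases "q3 = 0 \<and> p4 = 0 \<and> p3 = q4")
    case True
    then have F: "q3 = 0" "p4 = 0" "q4 = p3"
      by auto
    have q1: "q1 = - p1 * p3 - 1"
      using TF(1) by algebra
    have q2: "q2 = (1 - p2) * p3"
      using UF(1) by simp
    have "p2 + p3 * p1 = 0"
      using product_p[OF basis(3,1)]
      by (simp add: mult_nth known F q1 algebra_simps)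
    then have p2: "p2 = - p3 * p1"
      by algebra
    have "A \<subseteq> scalar_algebra p3 p1"
    proof
      fix X assume X: "X \<in> A"
      show "X \<in> scalar_algebra p3 p1"
        using rows[OF X] expand_p[OF X] expand_q[OF X]
        by (simp add: scalar_algebra_def F q1 q2 p2 algebra_simps)
    qed
    then have "A = scalar_algebra p3 p1"
      by (rule complement_eqI[OF A]) (simp add: scalar_algebra_def mat3_eq_iff)
    then show ?thesis
      by blast
  next
    case False
    have "p1 * p3 = p1 * q4" "(1 - p2) * p3 = (1 - p2) * q4"
      using TF(1,4) UF(1,4) by algebra+
    then have p1: "p1 = 0" and p2: "p2 = 1"
      using TF(2,3) UF(2,3) False by auto
    then have q2: "q2 = 0"
      using UF(1) by simp
    have q1: "q1 = - 1"
      using TF(1) p1 by algebra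
    have W_F: "p4 * p3 + q4 = p3" "p4 * q3 = q3" "p4 * p4 = p4" "p4 * q4 = 0"
      using product_p[OF basis(4,3)] product_q[OF basis(4,3)]
        product_p[OF basis(4,4)] product_q[OF basis(4,4)]
      by (simp_all add: mult_nth known)
    have p4: "p4 = 1" and q4: "q4 = 0"
      using W_F False by auto
    have "A \<subseteq> nonscalar_algebra p3 q3"
    proof
      fix X assume X: "X \<in> A"
      show "X \<in> nonscalar_algebra p3 q3"
        using rows[OF X] expand_p[OF X] expand_q[OF X]
        by (simp add: nonscalar_algebra_def p1 q1 p2 q2 p4 q4 algebra_simps)
    qed
    then have "A = nonscalar_algebra p3 q3"
      by (rule complement_eqI[OF A]) (simp add: nonscalar_algebra_def mat3_eq_iff)
    then show ?thesis
      by blast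
  qed
qed

section \<open>Removing the parameters\<close>

text \<open>The new matrix is similar to \<open>F + \<beta>\<close>, which has trace \<open>l + 2 \<beta>\<close> and determinant
  \<open>\<beta>\<^sup>2 + \<beta> l - s\<close>; the parameters of a nonscalar algebra are the trace and minus the determinant
  of its matrix.\<close>

lemma nonscalar_algebra_shift:
  "M_equivalent (nonscalar_algebra l s) (nonscalar_algebra (l + 2 * \<beta>) (s - \<beta> * l - \<beta>\<^sup>2))"
proof (rule M_equivalent_conjugationI[of "mat 1 + \<beta> *\<^sub>C E 2 3" "mat 1 - \<beta> *\<^sub>C E 2 3"])
  show "(mat 1 + \<beta> *\<^sub>C E 2 3) ** X ** (mat 1 - \<beta> *\<^sub>C E 2 3)
      \<in> nonscalar_algebra (l + 2 * \<beta>) (s - \<beta> * l - \<beta>\<^sup>2) \<longleftrightarrow> X \<in> nonscalar_algebra l s" for X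
    by (auto simp: nonscalar_algebra_def forall_3 entries algebra_simps power2_eq_square)
qed (auto simp: mat3_eq_iff entries mem_M_iff)

lemma scalar_algebra_shift:
  "M_equivalent (scalar_algebra l k) (scalar_algebra (l + \<beta>) k)"
proof (rule M_equivalent_conjugationI[of "mat 1 + \<beta> *\<^sub>C E 2 3" "mat 1 - \<beta> *\<^sub>C E 2 3"])
  fix X :: mat3
  let ?Y = "(mat 1 + \<beta> *\<^sub>C E 2 3) ** X ** (mat 1 - \<beta> *\<^sub>C E 2 3)"
  define p q where "p = X $ 2 $ 2 - (l * X $ 1 $ 2 + k * (X $ 2 $ 1 - l * X $ 3 $ 1))"
    and "q = X $ 2 $ 3 - (l * X $ 1 $ 3 - (k * l + 1) * (X $ 2 $ 1 - l * X $ 3 $ 1))"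
  \<comment> \<open>The defects in the two defining equations for \<open>?Y\<close> are \<open>p\<close> and \<open>q - \<beta> p\<close>.\<close>
  show "?Y \<in> scalar_algebra (l + \<beta>) k \<longleftrightarrow> X \<in> scalar_algebra l k"
  proof (cases "\<forall>j. X $ 1 $ j = X $ 3 $ j")
    case True
    then have rows: "X $ 1 $ 1 = X $ 3 $ 1" "X $ 1 $ 2 = X $ 3 $ 2" "X $ 1 $ 3 = X $ 3 $ 3"
      by simp_all
    have "?Y $ 2 $ 2 - ((l + \<beta>) * ?Y $ 1 $ 2 + k * (?Y $ 2 $ 1 - (l + \<beta>) * ?Y $ 3 $ 1)) = p"
      by (simp add: p_def rows entries algebra_simps)
    moreover have "?Y $ 2 $ 3 - ((l + \<beta>) * ?Y $ 1 $ 3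
        - (k * (l + \<beta>) + 1) * (?Y $ 2 $ 1 - (l + \<beta>) * ?Y $ 3 $ 1)) = q - \<beta> * p"
      by (simp add: p_def q_def rows entries algebra_simps)
    moreover have "?Y $ 1 $ j = ?Y $ 3 $ j" for j
      using exhaust_3[of j] by (auto simp: rows entries)
    ultimately have "?Y \<in> scalar_algebra (l + \<beta>) k \<longleftrightarrow> p = 0 \<and> q - \<beta> * p = 0"
      unfolding scalar_algebra_def mem_Collect_eq
      by (simp only: eq_iff_diff_eq_0[of "?Y $ 2 $ 2"] eq_iff_diff_eq_0[of "?Y $ 2 $ 3"] simp_thms)
    also have "\<dots> \<longleftrightarrow> p = 0 \<and> q = 0"
      by auto
    also have "\<dots> \<longleftrightarrow> X \<in> scalar_algebra l k"
      using True by (simp add: scalar_algebra_def p_def q_def)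
    finally show ?thesis .
  next
    case False
    then show ?thesis
      by (auto simp: scalar_algebra_def forall_3 entries)
  qed
qed (auto simp: mat3_eq_iff entries mem_M_iff)

lemma nonscalar_algebra_scale:
  assumes "\<alpha> \<noteq> 0"
  shows "M_equivalent (nonscalar_algebra 0 (1 / \<alpha>\<^sup>2)) (nonscalar_algebra 0 1)"
proof (rule M_equivalent_conjugationI[of "E 1 1 + \<alpha> *\<^sub>C E 2 2 + E 3 3"
        "E 1 1 + inverse \<alpha> *\<^sub>C E 2 2 + E 3 3"])
  show "(E 1 1 + \<alpha> *\<^sub>C E 2 2 + E 3 3) ** X ** (E 1 1 + inverse \<alpha> *\<^sub>C E 2 2 + E 3 3)
      \<in> nonscalar_algebra 0 1 \<longleftrightarrow> X \<in> nonscalar_algebra 0 (1 / \<alpha>\<^sup>2)" for X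
    using assms
    by (auto simp: nonscalar_algebra_def forall_3 entries field_simps power2_eq_square)
qed (use assms in \<open>auto simp: mat3_eq_iff entries mem_M_iff\<close>)

lemma scalar_algebra_scale:
  assumes "\<alpha> \<noteq> 0"
  shows "M_equivalent (scalar_algebra 0 \<alpha>) (scalar_algebra 0 1)"
proof (rule M_equivalent_conjugationI[of "E 1 1 + \<alpha> *\<^sub>C E 2 2 + E 3 3"
        "E 1 1 + inverse \<alpha> *\<^sub>C E 2 2 + E 3 3"])
  show "(E 1 1 + \<alpha> *\<^sub>C E 2 2 + E 3 3) ** X ** (E 1 1 + inverse \<alpha> *\<^sub>C E 2 2 + E 3 3)
      \<in> scalar_algebra 0 1 \<longleftrightarrow> X \<in> scalar_algebra 0 \<alpha>" for X
    using assms
    by (auto simp: scalar_algebra_def forall_3 entries field_simps)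
      (metis mult_minus_right mult_left_cancel)
qed (use assms in \<open>auto simp: mat3_eq_iff entries mem_M_iff\<close>)

lemma complement_normal_form:
  assumes A: "complements_M A"
  obtains S where "M_equivalent A S"
    "S \<in> {nonscalar_algebra 0 0, nonscalar_algebra 0 1, scalar_algebra 0 0, scalar_algebra 0 1}"
proof -
  obtain A' where A': "M_equivalent A A'" "\<And>X j. X \<in> A' \<Longrightarrow> X $ 1 $ j = X $ 3 $ j"
    using equal_rows_normal_form[OF A] by blast
  have "complements_M A'"
    using M_equivalent_complements_M[OF A'(1) A] .
  then consider l s where "A' = nonscalar_algebra l s" | l k where "A' = scalar_algebra l k"
    using equal_rows_classification A'(2) by blast
  then show thesis
  proof cases
    case 1
    define d where "d = s + l\<^sup>2 / 4"
    have "M_equivalent A' (nonscalar_algebra 0 d)"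
      using nonscalar_algebra_shift[of l s "- l / 2"]
      by (simp add: 1 d_def power2_eq_square add.commute)
    then have Ad: "M_equivalent A (nonscalar_algebra 0 d)"
      using M_equivalent_trans A'(1) by blast
    show thesis
    proof (cases "d = 0")
      case True
      then show thesis
        using Ad that by blast
    next
      case False
      define \<alpha> where "\<alpha> = inverse (csqrt d)"
      have "\<alpha> \<noteq> 0" "1 / \<alpha>\<^sup>2 = d"
        using False by (simp_all add: \<alpha>_def power_inverse divide_inverse)
      then have "M_equivalent (nonscalar_algebra 0 d) (nonscalar_algebra 0 1)"
        using nonscalar_algebra_scale[of \<alpha>] by simp
      then show thesis
        using M_equivalent_trans[OF Ad] that by blast
    qed
  next
    case 2
    have "M_equivalent A' (scalar_algebra 0 k)"
      using scalar_algebra_shift[of l k "- l"] by (simp add: 2)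
    then have Ak: "M_equivalent A (scalar_algebra 0 k)"
      using M_equivalent_trans A'(1) by blast
    show thesis
    proof (cases "k = 0")
      case True
      then show thesis
        using Ak that by blast
    next
      case False
      then show thesis
        using M_equivalent_trans[OF Ak scalar_algebra_scale] that by blast
    qed
  qed
qed

section \<open>The normal forms as spans\<close>

lemma nonscalar_algebra_0_0:
  "nonscalar_algebra 0 0 =
    M3.span {E 2 1 - E 2 3, E 1 1 + E 2 2 + E 3 1, E 1 2 + E 3 2, E 1 3 + E 2 2 + E 3 3}"
  by (auto simp: set_eq_iff mem_span4_iff mat3_eq_iff entries nonscalar_algebra_def forall_3)

lemma nonscalar_algebra_0_1:
  "nonscalar_algebra 0 1 =
    M3.span {E 2 1 - E 2 3, E 1 1 + E 2 2 + E 3 1, E 1 2 + E 2 3 + E 3 2, E 1 3 + E 2 2 + E 3 3}"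
  by (auto simp: set_eq_iff mem_span4_iff mat3_eq_iff entries nonscalar_algebra_def forall_3)

lemma scalar_algebra_0_0:
  "scalar_algebra 0 0 =
    M3.span {E 2 1 - E 2 3, E 1 1 + E 3 1, E 1 2 + E 3 2, E 1 3 + E 3 3}"
  by (auto simp: set_eq_iff mem_span4_iff mat3_eq_iff entries scalar_algebra_def forall_3)

lemma scalar_algebra_0_1:
  "scalar_algebra 0 1 =
    M3.span {E 2 1 + E 2 2 - E 2 3, E 1 1 + E 3 1, E 1 2 + E 3 2, E 1 3 + E 3 3}"
  by (auto simp: set_eq_iff mem_span4_iff mat3_eq_iff entries scalar_algebra_def forall_3)

theorem theorem5:
  fixes A B :: "mat3 set"
  assumes "subalgebra A" and "subalgebra B"
    and "direct_sum_decomp A B"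
    and "M3.dim A = 4" and "M3.dim B = 5"
    and "\<exists>\<psi>. (automorphism \<psi> \<or> antiautomorphism \<psi>) \<and> B = \<psi> ` M"
  shows "\<exists>\<phi> S. (automorphism \<phi> \<or> antiautomorphism \<phi>) \<and> \<phi> ` B = M \<and> \<phi> ` A = S \<and>
    (S = M3.span {E 2 1 - E 2 3, E 1 1 + E 2 2 + E 3 1, E 1 2 + E 3 2, E 1 3 + E 2 2 + E 3 3}
   \<or> S = M3.span {E 2 1 - E 2 3, E 1 1 + E 2 2 + E 3 1, E 1 2 + E 2 3 + E 3 2, E 1 3 + E 2 2 + E 3 3}
   \<or> S = M3.span {E 2 1 - E 2 3, E 1 1 + E 3 1, E 1 2 + E 3 2, E 1 3 + E 3 3}
   \<or> S = M3.span {E 2 1 + E 2 2 - E 2 3, E 1 1 + E 3 1, E 1 2 + E 3 2, E 1 3 + E 3 3}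
   \<or> (\<exists>s. S = M3.span {E 2 1 - E 2 3, E 1 1 + E 2 2 + E 3 1,
                       E 1 2 + E 2 2 + s *\<^sub>C E 2 3 + E 3 2, E 1 3 + E 2 2 + E 3 3})
   \<or> (\<exists>b. S = M3.span {E 2 1 + b *\<^sub>C E 2 2 - (b + 1) *\<^sub>C E 2 3, E 1 1 + E 2 1 + E 3 1,
                       E 1 2 + E 2 2 + E 3 2, E 1 3 + E 2 3 + E 3 3}))"
proof -
  obtain \<psi> where \<psi>: "algebra_symmetry \<psi>" "B = \<psi> ` M"
    using assms(6) by (auto simp: algebra_symmetry_def)
  define g where "g = inv \<psi>"
  have g: "algebra_symmetry g"
    using algebra_symmetry_inv[OF \<psi>(1)] by (simp add: g_def)
  have gB: "g ` B = M"
    using \<psi> by (simp add: g_def algebra_symmetry_iff bij_is_inj image_image)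
  have "complements_M (g ` A)"
    using subalgebra_image[OF g assms(1)] direct_sum_decomp_image[OF g assms(3)]
    by (simp add: complements_M_def gB)
  then obtain S where S: "M_equivalent (g ` A) S"
    "S \<in> {nonscalar_algebra 0 0, nonscalar_algebra 0 1, scalar_algebra 0 0, scalar_algebra 0 1}"
    by (rule complement_normal_form)
  then obtain f where f: "algebra_symmetry f" "f ` M = M" "f ` g ` A = S"
    by (auto simp: M_equivalent_def)
  have "automorphism (f \<circ> g) \<or> antiautomorphism (f \<circ> g)"
    using algebra_symmetry_comp[OF f(1) g] by (simp add: algebra_symmetry_def)
  moreover have "(f \<circ> g) ` B = M" "(f \<circ> g) ` A = S"
    using f gB by (simp_all only: image_comp[symmetric])
  moreover let "\<exists>\<phi> S. _ \<phi> \<and> _ \<phi> \<and> _ \<phi> S \<and> ?listed S" = ?thesis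
  have "?listed S"
    using S(2)
    unfolding insert_iff empty_iff
      nonscalar_algebra_0_0 nonscalar_algebra_0_1 scalar_algebra_0_0 scalar_algebra_0_1
    by argo
  ultimately show ?thesis
    by (intro exI[of _ "f \<circ> g"] exI[of _ S] conjI)
qed

end
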